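(* Let $f(x) = \sum_{k=0}^\infty a_k x^k$ be an entire function with $a_k > 0$ for all $k \geq 0$. Suppose that there exists a real number $\alpha$ with $1 + \sqrt{5} \leq \alpha < 4$ such that $$q_k(f) \in \left[\alpha, \frac{8}{\alpha(4 - \alpha)}\right] \quad \text{for all } k = 2, 3, \ldots$$ Then $f$ belongs to the Laguerre--P\'olya class.
   Context: For an entire function $f(x)=\sum_{k=0}^\infty a_k x^k$ with nonzero real coefficients, the second quotients of its Taylor coefficients are $q_k(f) := \frac{a_{k-1}^2}{a_{k-2}a_k}$ for $k \geq 2$. A real entire function $f$ is said to be in the Laguerre--P\'olya class if it can be expressed in the form $$f(z) = c z^n e^{-\gamma z^2+\delta z}\prod_{k}\left(1-\frac{z}{x_k}\right)e^{z x_k^{-1}},$$ where $c, \gamma, \delta, x_k \in \mathbb{R}$, $x_k \neq 0$, $\gamma \geq 0$, $n$ is a nonnegative integer, and $\sum_k x_k^{-2} < \infty$. The product may be infinite, finite or empty (in the last case it equals $1$). *)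

theory Defs
  imports "HOL-Analysis.Analysis"
begin

text \<open>Indexed as in the informal definition; meaningful for \<open>k \<ge> 2\<close> only
  (for smaller \<open>k\<close> the subtraction on natural numbers truncates).\<close>

definition second_quotient :: "(nat \<Rightarrow> real) \<Rightarrow> nat \<Rightarrow> real"
  where "second_quotient a k = (a (k - 1))\<^sup>2 / (a (k - 2) * a k)"

definition real_entire :: "(complex \<Rightarrow> complex) \<Rightarrow> bool"
  where "real_entire f \<longleftrightarrow> f holomorphic_on UNIV \<and> (\<forall>t::real. f (of_real t) \<in> \<real>)"

text \<open>The product runs over an index set \<open>K\<close> of natural numbers, which may be infinite, finite or
  empty; indices outside \<open>K\<close> contribute the factor \<open>1\<close>. The family \<open>x\<close> may repeat values, which
  accounts for multiple zeros. The relation \<open>has_prod\<close> includes the convergence of the product,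
  also at points where some of the factors vanish.\<close>

definition laguerre_polya :: "(complex \<Rightarrow> complex) \<Rightarrow> bool"
  where "laguerre_polya f \<longleftrightarrow>
    real_entire f \<and>
    (\<exists>(c::real) (n::nat) (\<gamma>::real) (\<delta>::real) (K::nat set) (x::nat \<Rightarrow> real).
      \<gamma> \<ge> 0 \<and>
      (\<forall>k\<in>K. x k \<noteq> 0) \<and>
      (\<lambda>k. 1 / (x k)\<^sup>2) summable_on K \<and>
      (\<forall>z. \<exists>P.
        (\<lambda>k. if k \<in> K then (1 - z / of_real (x k)) * exp (z / of_real (x k)) else 1) has_prod P \<and>
        f z = of_real c * z ^ n * exp (- of_real \<gamma> * z\<^sup>2 + of_real \<delta> * z) * P))"

end

(*
  Put f(-x) = sum (-1)^k a_k x^k. At x = sqrt (a_(m-1) / a_(m+1)) the term of index m is the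
  largest one, and the bounds on the second quotients make each of the two alternating sums that
  start at it, upwards and downwards, exceed half of it; so the sign at that point is (-1)^m. This
  needs two terms on either side of the m-th. For m = 1 the sign is governed by the quartic
  section: in the worst case q_2 = q_4 = alpha, q_3 = 8 / (alpha (4 - alpha)) it is self-reciprocal
  with two double roots, and the fifth-degree term makes the inequality strict. In a section of
  degree n the case m = n - 1 is the case m = 1 of the reversed polynomial.

  So every section of degree n >= 5 changes sign n times on the positive axis, and all its roots
  are real. For i >= 1 the i-th root, counted from 0, is at least a_(i-1) / a_i, which grows
  geometrically. Hence the reciprocal roots converge along a subsequence under a summable bound,
  and Tannery's theorem turns the factorizations of the sections into f = a_0 prod (1 + l_k z).
*)
theory Submission
  imports Defs
begin

section \<open>Alternating sums: recursion, reversal, and splitting at an index\<close>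

definition alternating_sum :: "(nat \<Rightarrow> real) \<Rightarrow> nat \<Rightarrow> real"
  where "alternating_sum u N = (\<Sum>k\<le>N. (- 1) ^ k * u k)"

lemma alternating_sum_0 [simp]: "alternating_sum u 0 = u 0"
  by (simp add: alternating_sum_def)

lemma alternating_sum_Suc: "alternating_sum u (Suc N) = u 0 - alternating_sum (\<lambda>k. u (Suc k)) N"
  by (simp add: alternating_sum_def sum.atMost_Suc_shift sum_negf del: sum.atMost_Suc)

lemma alternating_sum_cong:
  "(\<And>k. k \<le> N \<Longrightarrow> u k = v k) \<Longrightarrow> alternating_sum u N = alternating_sum v N"
  by (simp add: alternating_sum_def)

lemma alternating_sum_scale: "alternating_sum (\<lambda>k. c * u k) N = c * alternating_sum u N"
  by (simp add: alternating_sum_def sum_distrib_left algebra_simps)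

lemma alternating_sum_rev:
  "alternating_sum (\<lambda>k. u (N - k)) N = (- 1) ^ N * alternating_sum u N"
proof -
  have "(- 1) ^ (N - k) = (- 1) ^ N * ((- 1) ^ k :: real)" if "k \<le> N" for k
    using that by (auto simp: le_iff_add power_add simp flip: power_mult_distrib)
  moreover have "alternating_sum (\<lambda>k. u (N - k)) N = (\<Sum>k\<le>N. (- 1) ^ (N - k) * u k)"
    unfolding alternating_sum_def
    by (rule sum.reindex_bij_witness[where i = "\<lambda>k. N - k" and j = "\<lambda>k. N - k"]) auto
  ultimately show ?thesis
    by (simp add: alternating_sum_def sum_distrib_left mult.assoc)
qed

text \<open>Leibniz's estimate: peeling off \<open>u 0\<close> leaves an alternating sum in (0,
  \<open>u 1\<close>], and \<open>u 1 < u 0\<close>.\<close>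

lemma alternating_sum_bounds:
  assumes "\<And>k. u k > 0" and "\<And>k. k < N \<Longrightarrow> u (Suc k) < u k"
  shows "0 < alternating_sum u N \<and> alternating_sum u N \<le> u 0"
  using assms
proof (induction N arbitrary: u)
  case (Suc N)
  have "0 < alternating_sum (\<lambda>k. u (Suc k)) N \<and> alternating_sum (\<lambda>k. u (Suc k)) N \<le> u (Suc 0)"
    by (rule Suc.IH) (use Suc.prems in auto)
  with Suc.prems(2)[of 0] show ?case
    by (simp add: alternating_sum_Suc)
qed simp

text \<open>Both sums on the right start at the term of index \<open>m\<close>, hence it is
  subtracted once; the factor \<open>(- 1) ^ m\<close> lets it count positively.\<close>

lemma alternating_sum_split:
  assumes "m \<le> n"
  shows "(- 1) ^ m * alternating_sum u n =
    alternating_sum (\<lambda>k. u (m - k)) m + alternating_sum (\<lambda>k. u (m + k)) (n - m) - u m"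
proof -
  have "alternating_sum u n = (\<Sum>k<m. (- 1) ^ k * u k) + (\<Sum>k=m..n. (- 1) ^ k * u k)"
    unfolding alternating_sum_def using assms
    by (metis (no_types, lifting) atLeast0AtMost atLeast0LessThan sum.atLeastLessThan_concat
      atLeastLessThanSuc_atLeastAtMost le0 le_SucI)
  also have "(\<Sum>k<m. (- 1) ^ k * u k) = alternating_sum u m - (- 1) ^ m * u m"
    unfolding alternating_sum_def lessThan_Suc_atMost[symmetric] by simp
  also have "(\<Sum>k=m..n. (- 1) ^ k * u k) = (- 1) ^ m * alternating_sum (\<lambda>k. u (m + k)) (n - m)"
    unfolding alternating_sum_def sum_distrib_left using assms
    by (intro sum.reindex_bij_witness[where i = "\<lambda>k. m + k" and j = "\<lambda>k. k - m"])
      (auto simp flip: mult.assoc power_add)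
  finally show ?thesis
    by (simp add: alternating_sum_rev distrib_left right_diff_distrib
      flip: power_mult_distrib mult.assoc)
qed

section \<open>Sequences with second quotients in a given set\<close>

text \<open>Positivity at every index, with the quotients controlled only up to \<open>N\<close>,
  makes the notion fit sections, their shifts, and reversals, where truncated subtraction repeats
  \<open>u 0\<close> past the end.\<close>

definition quotients_within :: "real set \<Rightarrow> (nat \<Rightarrow> real) \<Rightarrow> nat \<Rightarrow> bool"
  where "quotients_within I u N \<longleftrightarrow>
    (\<forall>k. u k > 0) \<and> (\<forall>k\<in>{2..N}. second_quotient u k \<in> I)"

lemma quotients_within_pos: "quotients_within I u N \<Longrightarrow> u k > 0"
  by (simp add: quotients_within_def)

lemma quotients_within_nz: "quotients_within I u N \<Longrightarrow> u k \<noteq> 0"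
  using quotients_within_pos by (metis less_irrefl)

lemma second_quotient_add2: "second_quotient u (k + 2) = (u (k + 1))\<^sup>2 / (u k * u (k + 2))"
  by (simp add: second_quotient_def)

lemma quotients_withinD:
  "quotients_within I u N \<Longrightarrow> k + 2 \<le> N \<Longrightarrow> (u (k + 1))\<^sup>2 / (u k * u (k + 2)) \<in> I"
  unfolding quotients_within_def second_quotient_add2[symmetric] by auto

lemma quotients_withinI:
  assumes "\<And>k. u k > 0" and "\<And>k. k + 2 \<le> N \<Longrightarrow> (u (k + 1))\<^sup>2 / (u k * u (k + 2)) \<in> I"
  shows "quotients_within I u N"
  unfolding quotients_within_def
proof safe
  fix k assume "k \<in> {2..N}"
  then obtain j where "k = j + 2" "j + 2 \<le> N"
    by (metis add.commute atLeastAtMost_iff le_Suc_ex)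
  with assms(2) show "second_quotient u k \<in> I"
    by (simp add: second_quotient_def)
qed (fact assms(1))

text \<open>The powers of \<open>x\<close> cancel in a second quotient, so the terms of a section at
  a point satisfy the same bounds as its coefficients.\<close>

lemma quotients_within_geometric:
  assumes "quotients_within I u N" and "x > 0"
  shows "quotients_within I (\<lambda>k. u k * x ^ k) N"
proof (rule quotients_withinI)
  fix k assume k: "k + 2 \<le> N"
  have "(u (k + 1) * x ^ (k + 1))\<^sup>2 / (u k * x ^ k * (u (k + 2) * x ^ (k + 2))) =
      (u (k + 1))\<^sup>2 / (u k * u (k + 2))"
    using assms(2) quotients_within_nz[OF assms(1)]
    by (simp add: divide_simps power2_eq_square power_add)
  with quotients_withinD[OF assms(1) k]
  show "(u (k + 1) * x ^ (k + 1))\<^sup>2 / (u k * x ^ k * (u (k + 2) * x ^ (k + 2))) \<in> I"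
    by simp
qed (use assms quotients_within_pos in auto)

lemma quotients_within_shift:
  assumes "quotients_within I u n" and "m \<le> n"
  shows "quotients_within I (\<lambda>k. u (m + k)) (n - m)"
proof (rule quotients_withinI)
  fix k assume "k + 2 \<le> n - m"
  with quotients_withinD[OF assms(1), of "m + k"] assms(2)
  show "(u (m + (k + 1)))\<^sup>2 / (u (m + k) * u (m + (k + 2))) \<in> I"
    by (simp add: add.assoc)
qed (use assms quotients_within_pos in auto)

text \<open>A second quotient is symmetric in its two outer entries.\<close>

lemma quotients_within_rev:
  assumes "quotients_within I u n" and "m \<le> n"
  shows "quotients_within I (\<lambda>k. u (m - k)) m"
proof (rule quotients_withinI)
  fix k assume k: "k + 2 \<le> m"
  then have *: "m - k = m - (k + 2) + 2" "m - (k + 1) = m - (k + 2) + 1"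
    by auto
  show "(u (m - (k + 1)))\<^sup>2 / (u (m - k) * u (m - (k + 2))) \<in> I"
    using quotients_withinD[OF assms(1), of "m - (k + 2)"] assms(2) k
    unfolding * by (simp add: mult.commute)
qed (use assms quotients_within_pos in auto)

text \<open>Second quotients above 1 make the ratios \<open>u (k + 1) / u k\<close> strictly
  decrease. The first ratio may equal 1, so the strict descent starts at index 1.\<close>

lemma quotients_within_decreasing:
  assumes u: "quotients_within I u N" and I: "I \<subseteq> {1<..}" and "u 1 \<le> u 0"
    and "1 \<le> k" and "k < N"
  shows "u (Suc k) < u k"
proof -
  have strict: "u (k + 2) < u (k + 1)" if "u (k + 1) \<le> u k" "k + 2 \<le> N" for k
  proof -
    note pos = quotients_within_pos[OF u]
    have "1 < (u (k + 1))\<^sup>2 / (u k * u (k + 2))"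
      using quotients_withinD[OF u that(2)] I by auto
    then have "u k * u (k + 2) < u (k + 1) * u (k + 1)"
      using pos by (simp add: less_divide_eq power2_eq_square)
    also have "\<dots> \<le> u k * u (k + 1)"
      using that pos[of "k + 1"] by (simp add: mult_right_mono)
    finally show ?thesis
      using pos[of k] by simp
  qed
  show ?thesis
    using assms(4,5)
  proof (induction k rule: dec_induct)
    case base
    then show ?case using strict[of 0] assms(3) by (simp add: numeral_2_eq_2)
  next
    case (step j)
    then show ?case using strict[of j] by simp
  qed
qed

text \<open>The difference \<open>u 0 - u 1\<close> may vanish; strict positivity comes from the
  terms from index 2 on.\<close>

lemma alternating_sum_pos:
  assumes u: "quotients_within I u N" and I: "I \<subseteq> {1<..}" and "u 1 \<le> u 0" and "2 \<le> N"
  shows "0 < alternating_sum u N"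
proof -
  obtain M where M: "N = Suc (Suc M)"
    using \<open>2 \<le> N\<close> by (metis add_2_eq_Suc le_Suc_ex)
  have "0 < alternating_sum (\<lambda>k. u (Suc (Suc k))) M"
    using alternating_sum_bounds[of "\<lambda>k. u (Suc (Suc k))" M]
      quotients_within_decreasing[OF u I assms(3)] quotients_within_pos[OF u] M
    by auto
  then show ?thesis
    using assms(3) by (simp add: M alternating_sum_Suc)
qed

section \<open>The sign where an interior term dominates\<close>

text \<open>Named after Hutchinson's theorem, in which all second quotients are at least 4: as
  \<alpha> approaches 4, the upper end tends to infinity. Within 2 < \<alpha> < 4 the two ends meet
  at \<alpha> = 1 + sqrt 5.\<close>

abbreviation hutchinson_interval :: "real \<Rightarrow> real set"
  where "hutchinson_interval \<alpha> \<equiv> {\<alpha>..8 / (\<alpha> * (4 - \<alpha>))}"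

text \<open>Meant for either half of a section split at its largest term \<open>u 0\<close>;
  \<open>b\<close> is the second quotient centred there, and the point is chosen so that
  \<open>b\<close> is the square of \<open>u 0 / u 1\<close>. Three terms decide: the tail costs at
  most a tenth of \<open>u 2\<close>. The bound \<open>16 / 5\<close> is a rational number just
  below 1 + sqrt 5.\<close>

lemma alternating_sum_gt_half:
  assumes \<alpha>: "16 / 5 \<le> \<alpha>" "\<alpha> < 4"
    and u: "quotients_within (hutchinson_interval \<alpha>) u N" and "2 \<le> N"
    and b: "b \<in> hutchinson_interval \<alpha>" and u01: "(u 0)\<^sup>2 = b * (u 1)\<^sup>2"
  shows "u 0 / 2 < alternating_sum u N"
proof -
  note pos = quotients_within_pos[OF u]
  have I: "hutchinson_interval \<alpha> \<subseteq> {1<..}"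
    using \<alpha> by auto
  define r where "r = u 0 / u 1"
  have r0: "r > 0"
    using pos by (simp add: r_def)
  have r2: "r\<^sup>2 = b"
    using u01 pos[of 1] by (simp add: r_def power_divide)
  have r: "r \<ge> 7 / 4"
  proof (rule power2_le_imp_le)
    show "(7 / 4)\<^sup>2 \<le> r\<^sup>2"
      unfolding r2 using b \<alpha> by (simp add: power2_eq_square)
  qed (use r0 in auto)
  have u0: "u 0 = r * u 1"
    using pos[of 1] by (simp add: r_def)
  have u1: "u 1 \<le> u 0"
    unfolding u0 using mult_right_mono[of 1 r "u 1"] r pos[of 1] by simp
  note dec = quotients_within_decreasing[OF u I u1]
  define c where "c = (u 1)\<^sup>2 / (u 0 * u 2)"
  have c: "c \<in> hutchinson_interval \<alpha>"
    unfolding c_def using quotients_withinD[OF u, of 0] \<open>2 \<le> N\<close> by (simp add: numeral_2_eq_2)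
  have u2: "u 2 = u 1 / (c * r)"
    using pos[of 1] pos[of 2] r0 unfolding c_def u0
    by (simp add: field_simps power2_eq_square)
  have c0: "c > 0"
    using c \<alpha> by auto
  \<comment> \<open>The terms after \<open>u 2\<close> contribute at least \<open>- u 3\<close>, and
    \<open>u 2 / u 3 = c * r * e\<close> is at least 10.\<close>
  have lower: "u 0 - u 1 + 9 / 10 * u 2 \<le> alternating_sum u N"
  proof (cases "N = 2")
    case True
    then show ?thesis
      using pos[of 2] by (simp add: numeral_2_eq_2 alternating_sum_Suc)
  next
    case False
    then obtain M where M: "N = Suc (Suc (Suc M))"
      using \<open>2 \<le> N\<close> by (metis add_2_eq_Suc le_Suc_ex not0_implies_Suc add_0_right One_nat_def Suc_1)
    define e where "e = (u 2)\<^sup>2 / (u 1 * u 3)"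
    have "\<alpha> \<le> e"
      using quotients_withinD[OF u, of 1] M
      by (simp add: e_def numeral_2_eq_2 numeral_3_eq_3)
    then have e: "e \<ge> 16 / 5"
      using \<alpha> by simp
    have u1_eq: "u 1 = c * r * u 2"
      using u2 c0 r0 by simp
    have u3: "u 3 = u 2 * (1 / (c * r * e))"
      using pos[of 2] pos[of 3] c0 r0 unfolding e_def u1_eq
      by (simp add: field_simps power2_eq_square)
    have "10 \<le> (16 / 5 * (7 / 4)) * (16 / 5 :: real)"
      by simp
    also have "\<dots> \<le> c * r * e"
      using c \<alpha> r e by (intro mult_mono) auto
    finally have "u 2 * (1 / (c * r * e)) \<le> u 2 * (1 / 10)"
      using pos[of 2] by (intro mult_left_mono divide_left_mono) auto
    then have "u 3 \<le> u 2 / 10"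
      using u3 by simp
    moreover have "alternating_sum (\<lambda>k. u (Suc (Suc (Suc k)))) M \<le> u 3"
      using alternating_sum_bounds[of "\<lambda>k. u (Suc (Suc (Suc k)))" M] pos dec M
      by (simp add: numeral_3_eq_3)
    ultimately show ?thesis
      using M by (simp add: alternating_sum_Suc numeral_2_eq_2)
  qed
  have "1 / 2 < 1 - 1 / r + 9 / (10 * c * r\<^sup>2)"
  proof (cases "r \<le> 2")
    case False
    then have "1 / r < 1 / 2"
      using r0 by (simp add: field_simps)
    moreover have "0 < 9 / (10 * c * r\<^sup>2)"
      using c0 r0 by simp
    ultimately show ?thesis by linarith
  next
    case True
    have b4: "b \<le> 4"
      using power_mono[of r 2 2] True r0 r2 by simp
    \<comment> \<open>t (4 - t) decreases for t \<ge> 2, so the upper bound for \<open>c\<close> in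
      terms of \<alpha> gives the same bound in terms of \<open>b = r\<^sup>2\<close>, and only
      \<open>r\<close> remains.\<close>
    have "0 \<le> (b - \<alpha>) * (b + \<alpha> - 4)"
      using b \<alpha> by (intro mult_nonneg_nonneg) auto
    then have "b * (4 - b) \<le> \<alpha> * (4 - \<alpha>)"
      by (simp add: algebra_simps)
    moreover have "c * (\<alpha> * (4 - \<alpha>)) \<le> 8"
      using c \<alpha> by (simp add: pos_le_divide_eq)
    ultimately have "c * (b * (4 - b)) \<le> 8"
      using c0 by (meson mult_left_mono order_trans less_imp_le)
    then have "9 * (4 - b) / 80 \<le> 9 / (10 * c * b)"
      using c0 r0 r2 b \<alpha> by (simp add: field_simps)
    moreover have "1 / 2 < 1 - 1 / r + 9 * (4 - b) / 80" if "r < 2"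
    proof -
      \<comment> \<open>This is the left side of the claim minus its right side, times
        \<open>80 * r\<close>. Since r \<ge> 7/4, the product \<open>9 * r * (2 + r)\<close> exceeds
        59.\<close>
      have "(2 - r) * (40 - 9 * r * (2 + r)) < 0"
        using r that mult_mono[of "7 / 4" r "15 / 4" "2 + r"]
        by (intro mult_pos_neg) auto
      then show ?thesis
        using r0 unfolding r2[symmetric] by (simp add: field_simps power2_eq_square)
    qed
    moreover have "0 < 9 / (10 * c * b)"
      using c0 r0 r2 by auto
    moreover have "1 / r = 1 / 2" if "r = 2"
      using that by simp
    ultimately show ?thesis
      using True unfolding r2 by linarith
  qed
  then have "u 0 * (1 / 2) < u 0 * (1 - 1 / r + 9 / (10 * c * r\<^sup>2))"
    using pos[of 0] by (intro mult_strict_left_mono)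
  also have "\<dots> = u 0 - u 1 + 9 / 10 * u 2"
    unfolding u0 u2 using r0 c0 by (simp add: field_simps power2_eq_square)
  finally show ?thesis
    using lower by simp
qed

text \<open>At this point the two neighbours of the term of index \<open>m\<close> are equal, so
  both halves start with the same ratio, whose square is a second quotient. Each half exceeds half
  of the shared term, which is subtracted once.\<close>

lemma alternating_sum_interior_pos:
  assumes \<alpha>: "16 / 5 \<le> \<alpha>" "\<alpha> < 4"
    and a: "quotients_within (hutchinson_interval \<alpha>) a n" and m: "2 \<le> m" "m + 2 \<le> n"
  shows "0 < (- 1) ^ m * alternating_sum (\<lambda>k. a k * sqrt (a (m - 1) / a (m + 1)) ^ k) n"
proof -
  note pos = quotients_within_pos[OF a]
  define x where "x = sqrt (a (m - 1) / a (m + 1))"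
  have x: "x > 0" and x2: "x\<^sup>2 = a (m - 1) / a (m + 1)"
    using pos[of "m - 1"] pos[of "m + 1"] by (auto simp: x_def)
  define T where "T k = a k * x ^ k" for k
  have T: "quotients_within (hutchinson_interval \<alpha>) T n"
    unfolding T_def by (rule quotients_within_geometric[OF a x])
  obtain j where j: "m = Suc j"
    using m by (cases m) auto
  have eq: "T (m - 1) = T (m + 1)"
    using x2 pos[of "m + 1"] by (simp add: T_def j power2_eq_square)
  define b where "b = (T m)\<^sup>2 / (T (m - 1) * T (m + 1))"
  have b: "b \<in> hutchinson_interval \<alpha>"
    using quotients_withinD[OF T, of "m - 1"] m by (simp add: b_def j)
  have "T (m + 1) \<noteq> 0"
    by (rule quotients_within_nz[OF T])
  then have Tm: "(T m)\<^sup>2 = b * (T (m + 1))\<^sup>2"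
    unfolding b_def eq by (simp add: power2_eq_square)
  have "T m / 2 < alternating_sum (\<lambda>k. T (m - k)) m"
    using alternating_sum_gt_half[OF \<alpha> quotients_within_rev[OF T, of m] _ b] m Tm eq by simp
  moreover have "T m / 2 < alternating_sum (\<lambda>k. T (m + k)) (n - m)"
    using alternating_sum_gt_half[OF \<alpha> quotients_within_shift[OF T, of m] _ b] m Tm by simp
  ultimately show ?thesis
    using alternating_sum_split[of m n T] m
    unfolding x_def[symmetric] T_def[symmetric] by simp
qed

section \<open>The first sign change, from the quartic section\<close>

text \<open>The expression is the alternating sum of the first five terms at
  \<open>t * u 1 / u 2\<close>, divided by the term of index 1, when \<open>q2\<close>,
  \<open>q3\<close>, \<open>q4\<close> are the second quotients of \<open>u\<close>.\<close>

lemma quartic_nonpos: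
  fixes \<alpha> q2 q3 q4 :: real
  assumes \<alpha>: "16 / 5 \<le> \<alpha>" "\<alpha> < 4"
    and q: "\<alpha> \<le> q2" "\<alpha> \<le> q3" "q3 \<le> 8 / (\<alpha> * (4 - \<alpha>))" "\<alpha> \<le> q4"
  obtains t where "0 < t" "t < 1" "1 / (t * q2) - 1 + t - t\<^sup>2 / q3 + t ^ 3 / (q3\<^sup>2 * q4) \<le> 0"
proof -
  \<comment> \<open>The worst case is \<open>q2 = q4 = \<alpha>\<close>, \<open>q3 = 8 / (\<alpha> * (4 - \<alpha>))\<close>. There the quartic is
    self-reciprocal and, up to a factor, the square of \<open>g t\<close>.\<close>
  define g where "g t = (4 - \<alpha>) * t\<^sup>2 - 4 * t + 8 / \<alpha>" for t
  have "\<exists>t\<ge>0. t \<le> 1 \<and> g t = 0"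
  proof (rule IVT2')
    have "8 < \<alpha> * \<alpha>"
      using mult_mono[of "16 / 5" \<alpha> "16 / 5" \<alpha>] \<alpha> by simp
    then show "g 1 \<le> 0"
      using \<alpha> by (simp add: g_def field_simps)
    show "continuous_on {0..1} g"
      unfolding g_def by (intro continuous_intros)
  qed (use \<alpha> in \<open>auto simp: g_def\<close>)
  then obtain t where t: "0 \<le> t" "t \<le> 1" "g t = 0"
    by blast
  have "t \<noteq> 0"
    using t(3) \<alpha> by (auto simp: g_def)
  have "t \<noteq> 1"
  proof
    assume "t = 1"
    then have "\<alpha> * \<alpha> = 8"
      using t(3) \<alpha> by (simp add: g_def field_simps)
    then show False
      using mult_mono[of "16 / 5" \<alpha> "16 / 5" \<alpha>] \<alpha> by simp
  qed
  have t0: "0 < t" "t < 1"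
    using t \<open>t \<noteq> 0\<close> \<open>t \<noteq> 1\<close> by auto
  define w where "w = \<alpha> * (4 - \<alpha>) / 8"
  define v where "v = 1 / q3"
  have v: "w \<le> v" "v \<le> 1 / \<alpha>"
    using q \<alpha> unfolding v_def w_def by (auto simp: field_simps)
  have w0: "0 < w"
    using \<alpha> by (simp add: w_def)
  have "1 / (t * q2) \<le> 1 / (t * \<alpha>)"
    using q \<alpha> t0 by (intro divide_left_mono mult_left_mono) auto
  moreover have "t ^ 3 / (q3\<^sup>2 * q4) \<le> t ^ 3 / (q3\<^sup>2 * \<alpha>)"
    using q \<alpha> t0 by (intro divide_left_mono mult_left_mono) auto
  moreover have "t ^ 3 / (q3\<^sup>2 * \<alpha>) = t ^ 3 * v\<^sup>2 / \<alpha>" "t\<^sup>2 / q3 = t\<^sup>2 * v"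
    by (simp_all add: v_def power_divide)
  \<comment> \<open>As a function of \<open>v\<close> this is a parabola, on its decreasing branch
    for \<open>v \<le> 1 / \<alpha>\<close>; hence the smallest value \<open>w\<close> is the
    worst.\<close>
  moreover have "t ^ 3 * v\<^sup>2 / \<alpha> - t\<^sup>2 * v \<le> t ^ 3 * w\<^sup>2 / \<alpha> - t\<^sup>2 * w"
  proof -
    have "t * (v + w) \<le> 1 * (1 / \<alpha> + 1 / \<alpha>)"
      using t0 v w0 by (intro mult_mono) auto
    also have "\<dots> \<le> \<alpha>"
      using \<alpha> mult_mono[of "16 / 5" \<alpha> "16 / 5" \<alpha>] by (simp add: field_simps)
    finally have "0 \<le> t\<^sup>2 * (v - w) * (\<alpha> - t * (v + w)) / \<alpha>"
      using v \<alpha> by simp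
    also have "\<dots> = t ^ 3 * w\<^sup>2 / \<alpha> - t\<^sup>2 * w - (t ^ 3 * v\<^sup>2 / \<alpha> - t\<^sup>2 * v)"
      using \<alpha> by (simp add: field_simps power2_eq_square power3_eq_cube)
    finally show ?thesis by simp
  qed
  \<comment> \<open>The equation \<open>g t = 0\<close> makes both \<open>t\<^sup>2 * w\<close> and
    \<open>1 / (t * \<alpha>)\<close> linear in \<open>t\<close>, after which everything
    cancels.\<close>
  moreover have "1 / (t * \<alpha>) - 1 + t + (t ^ 3 * w\<^sup>2 / \<alpha> - t\<^sup>2 * w) = 0"
  proof -
    have t2w: "t\<^sup>2 * w = \<alpha> * t / 2 - 1"
      using t(3) \<alpha> by (simp add: w_def g_def field_simps)
    have inv: "1 / (t * \<alpha>) = (4 - (4 - \<alpha>) * t) / 8"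
      using t(3) \<alpha> t0 by (simp add: g_def field_simps power2_eq_square)
    have cubic: "t ^ 3 * w\<^sup>2 / \<alpha> = (t\<^sup>2 * w)\<^sup>2 / (t * \<alpha>)"
      using t0 \<alpha> by (simp add: field_simps power2_eq_square power3_eq_cube)
    have square: "(\<alpha> * t / 2 - 1)\<^sup>2 / (t * \<alpha>) = \<alpha> * t / 4 - 1 + 1 / (t * \<alpha>)"
      using t0 \<alpha> by (simp add: field_simps power2_eq_square)
    show ?thesis
      unfolding cubic t2w square inv by (simp add: field_simps)
  qed
  ultimately have "1 / (t * q2) - 1 + t - t\<^sup>2 / q3 + t ^ 3 / (q3\<^sup>2 * q4) \<le> 0"
    by linarith
  with t0 show ?thesis
    using that by blast
qed

text \<open>The first five terms sum to at most 0; the remaining ones start with a negative term and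
  decrease in size, which gives strictness. The location of \<open>x\<close> serves to order the
  sign changes later.\<close>

lemma ex_alternating_sum_neg:
  assumes \<alpha>: "16 / 5 \<le> \<alpha>" "\<alpha> < 4"
    and u: "quotients_within (hutchinson_interval \<alpha>) u N" and N: "5 \<le> N"
  obtains x where "u 0 / u 1 < x" "x < u 1 / u 2" "alternating_sum (\<lambda>k. u k * x ^ k) N < 0"
proof -
  note pos = quotients_within_pos[OF u]
  have I: "hutchinson_interval \<alpha> \<subseteq> {1<..}"
    using \<alpha> by auto
  define q2 q3 q4 where q_defs: "q2 = (u 1)\<^sup>2 / (u 0 * u 2)" "q3 = (u 2)\<^sup>2 / (u 1 * u 3)"
    "q4 = (u 3)\<^sup>2 / (u 2 * u 4)"
  have "q2 \<in> hutchinson_interval \<alpha>" "q3 \<in> hutchinson_interval \<alpha>" "q4 \<in> hutchinson_interval \<alpha>"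
    using quotients_withinD[OF u, of 0] quotients_withinD[OF u, of 1]
      quotients_withinD[OF u, of 2] N
    unfolding q_defs by (simp_all add: eval_nat_numeral)
  then obtain t where t: "0 < t" "t < 1"
    and t_le: "1 / (t * q2) - 1 + t - t\<^sup>2 / q3 + t ^ 3 / (q3\<^sup>2 * q4) \<le> 0"
    using quartic_nonpos[OF \<alpha>, of q2 q3 q4] by auto
  define x where "x = t * u 1 / u 2"
  have x: "x > 0"
    using t pos by (simp add: x_def)
  define T where "T k = u k * x ^ k" for k
  have T: "quotients_within (hutchinson_interval \<alpha>) T N"
    unfolding T_def by (rule quotients_within_geometric[OF u x])
  note T_pos = quotients_within_pos[OF T]
  \<comment> \<open>\<open>T 0\<close> is dropped because it lies below \<open>T 1\<close>; the
    terms decrease only from \<open>T 1\<close> on.\<close>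
  have T': "quotients_within (hutchinson_interval \<alpha>) (\<lambda>k. T (1 + k)) (N - 1)"
    using quotients_within_shift[OF T, of 1] N by simp
  have nz: "u 0 \<noteq> 0" "u 1 \<noteq> 0" "u 2 \<noteq> 0" "u 3 \<noteq> 0" "u 4 \<noteq> 0" "t \<noteq> 0"
    using quotients_within_nz[OF u] t by auto
  have T012: "T 0 = T 1 * (1 / (t * q2))" "T 2 = T 1 * t"
    using nz unfolding T_def q_defs x_def by (simp_all add: field_simps power2_eq_square)
  have T34: "T 3 = T 1 * (t\<^sup>2 / q3)" "T 4 = T 1 * (t ^ 3 / (q3\<^sup>2 * q4))"
    using nz unfolding T_def q_defs x_def by (simp_all add: field_simps eval_nat_numeral)
  have "T 0 - T 1 + T 2 - T 3 + T 4
      = T 1 * (1 / (t * q2) - 1 + t - t\<^sup>2 / q3 + t ^ 3 / (q3\<^sup>2 * q4))"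
    unfolding T012 T34 by (simp add: algebra_simps)
  also have "\<dots> \<le> 0"
    using t_le T_pos[of 1] by (simp add: mult_le_0_iff)
  finally have head: "T 0 - T 1 + T 2 - T 3 + T 4 \<le> 0" .
  have "T 2 \<le> T 1"
    using T012(2) t T_pos[of 1] by simp
  then have "0 < alternating_sum (\<lambda>k. T (5 + k)) (N - 5)"
    using alternating_sum_bounds[of "\<lambda>k. T (5 + k)" "N - 5"] T_pos
      quotients_within_decreasing[OF T' I, of "4 + _"]
    by (simp add: eval_nat_numeral)
  moreover obtain L where "N = 5 + L"
    using N le_Suc_ex by blast
  then have "alternating_sum T N =
      T 0 - T 1 + T 2 - T 3 + T 4 - alternating_sum (\<lambda>k. T (5 + k)) (N - 5)"
    by (simp add: alternating_sum_Suc eval_nat_numeral)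
  ultimately have neg: "alternating_sum T N < 0"
    using head by simp
  \<comment> \<open>Up to \<open>u 0 / u 1\<close> the terms never increase, so the alternating sum
    would be positive.\<close>
  have "u 0 / u 1 < x"
  proof (rule ccontr)
    assume "\<not> u 0 / u 1 < x"
    then have "T 1 \<le> T 0"
      using pos by (simp add: T_def field_simps not_less)
    then show False
      using alternating_sum_pos[OF T I] N neg by simp
  qed
  moreover have "x < u 1 / u 2"
    using t pos by (simp add: x_def divide_strict_right_mono)
  ultimately show ?thesis
    using that neg unfolding T_def by blast
qed

section \<open>Sign changes of a section on the positive axis\<close>

text \<open>Carries signs of the reversed section at \<open>y\<close> to the section itself at
  \<open>1 / y\<close>, for the last two sign changes.\<close>

lemma alternating_sum_reciprocal:
  fixes y :: real
  assumes "y \<noteq> 0"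
  shows "alternating_sum (\<lambda>k. a (n - k) * y ^ k) n =
    y ^ n * ((- 1) ^ n * alternating_sum (\<lambda>k. a k * (1 / y) ^ k) n)"
proof -
  have "alternating_sum (\<lambda>k. a (n - k) * y ^ k) n =
      alternating_sum (\<lambda>k. y ^ n * (a (n - k) * (1 / y) ^ (n - k))) n"
    using assms by (intro alternating_sum_cong) (simp add: power_diff field_simps)
  also have "\<dots> = y ^ n * alternating_sum (\<lambda>k. a (n - k) * (1 / y) ^ (n - k)) n"
    by (rule alternating_sum_scale)
  also have "\<dots> = y ^ n * ((- 1) ^ n * alternating_sum (\<lambda>k. a k * (1 / y) ^ k) n)"
    using alternating_sum_rev[of "\<lambda>j. a j * (1 / y) ^ j" n] by simp
  finally show ?thesis .
qed

text \<open>The square root is the geometric mean of the two outer ratios, and the quotient of these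
  ratios is a second quotient, hence above 1.\<close>

lemma sqrt_quotient_between:
  assumes u: "quotients_within I u n" and I: "I \<subseteq> {1<..}" and k: "k + 2 \<le> n"
  shows "u k / u (k + 1) < sqrt (u k / u (k + 2))"
    and "sqrt (u k / u (k + 2)) < u (k + 1) / u (k + 2)"
proof -
  note pos = quotients_within_pos[OF u]
  have "1 < (u (k + 1))\<^sup>2 / (u k * u (k + 2))"
    using quotients_withinD[OF u k] I by auto
  then have *: "u k * u (k + 2) < (u (k + 1))\<^sup>2"
    using pos by (simp add: less_divide_eq)
  have "(u k / u (k + 1))\<^sup>2 < u k / u (k + 2)"
    using * pos[of k] pos[of "k + 1"] pos[of "k + 2"]
    by (simp add: field_simps power2_eq_square)
  then show "u k / u (k + 1) < sqrt (u k / u (k + 2))"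
    by (rule real_less_rsqrt)
  have "u k / u (k + 2) < (u (k + 1) / u (k + 2))\<^sup>2"
    using * pos[of k] pos[of "k + 1"] pos[of "k + 2"]
    by (simp add: field_simps power2_eq_square)
  then show "sqrt (u k / u (k + 2)) < u (k + 1) / u (k + 2)"
    using pos by (intro real_less_lsqrt) (auto simp: less_imp_le)
qed

text \<open>The increasing ratios \<open>a (i - 1) / a i\<close> separate the points: for 0 < i < n,
  \<open>\<xi> i\<close> lies between the ratios of index \<open>i\<close> and \<open>i + 1\<close>,
  while \<open>\<xi> 0\<close> and \<open>\<xi> n\<close> are the first and the last ratio. The
  maximum in the lower bound lets index 0 share the bound of index 1.\<close>

lemma ex_sign_changes:
  assumes \<alpha>: "16 / 5 \<le> \<alpha>" "\<alpha> < 4"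
    and a: "quotients_within (hutchinson_interval \<alpha>) a n" and n: "5 \<le> n"
  obtains \<xi> :: "nat \<Rightarrow> real" where
    "\<And>i. i \<le> n \<Longrightarrow> 0 < (- 1) ^ i * alternating_sum (\<lambda>k. a k * \<xi> i ^ k) n"
    "\<And>i. i < n \<Longrightarrow> \<xi> i < \<xi> (Suc i)"
    "\<And>i. i < n \<Longrightarrow> a (max 1 i - 1) / a (max 1 i) \<le> \<xi> i"
proof -
  note pos = quotients_within_pos[OF a]
  have I: "hutchinson_interval \<alpha> \<subseteq> {1<..}"
    using \<alpha> by auto
  obtain x where x: "a 0 / a 1 < x" "x < a 1 / a 2" "alternating_sum (\<lambda>k. a k * x ^ k) n < 0"
    by (rule ex_alternating_sum_neg[OF \<alpha> a n])
  have rev: "quotients_within (hutchinson_interval \<alpha>) (\<lambda>k. a (n - k)) n"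
    using quotients_within_rev[OF a, of n] by simp
  obtain y where y: "a n / a (n - 1) < y" "y < a (n - 1) / a (n - 2)"
    "alternating_sum (\<lambda>k. a (n - k) * y ^ k) n < 0"
    using ex_alternating_sum_neg[OF \<alpha> rev n, unfolded diff_zero] by blast
  have y0: "y > 0"
    using y(1) pos[of n] pos[of "n - 1"] by (meson divide_pos_pos less_trans)
  define \<xi> where "\<xi> i = (if i = 0 then a 0 / a 1 else if i = 1 then x
    else if i \<le> n - 2 then sqrt (a (i - 1) / a (i + 1))
    else if i = n - 1 then 1 / y else a (n - 1) / a n)" for i
  have \<xi>_0: "\<xi> 0 = a 0 / a 1" and \<xi>_1: "\<xi> (Suc 0) = x"
    by (auto simp: \<xi>_def)
  have \<xi>_mid: "\<xi> i = sqrt (a (i - 1) / a (i + 1))" if "2 \<le> i" "i \<le> n - 2" for i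
    using that by (auto simp: \<xi>_def)
  have \<xi>_pred: "\<xi> (n - 1) = 1 / y" and \<xi>_n: "\<xi> n = a (n - 1) / a n"
    using n by (auto simp: \<xi>_def)
  have cases: "i = 0 \<or> i = Suc 0 \<or> 2 \<le> i \<and> i \<le> n - 2 \<or> i = n - 1 \<or> i = n" if "i \<le> n" for i
    using that by auto
  have mid: "a (i - 1) / a i < \<xi> i" "\<xi> i < a i / a (i + 1)" if "2 \<le> i" "i \<le> n - 2" for i
    using sqrt_quotient_between[OF a I, of "i - 1"] that n by (simp_all add: \<xi>_mid)
  have y_bounds: "a (n - 2) / a (n - 1) < 1 / y" "1 / y < a (n - 1) / a n"
    using y y0 pos[of n] pos[of "n - 1"] pos[of "n - 2"] by (simp_all add: field_simps)
  show ?thesis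
  proof
    fix i assume "i \<le> n"
    then consider "i = 0" | "i = Suc 0" | "2 \<le> i" "i \<le> n - 2" | "i = n - 1" | "i = n"
      using cases by blast
    then show "0 < (- 1) ^ i * alternating_sum (\<lambda>k. a k * \<xi> i ^ k) n"
    proof cases
      case 1
      have "a 0 / a 1 > 0"
        using pos by simp
      from alternating_sum_pos[OF quotients_within_geometric[OF a this] I] n pos[of 1]
      show ?thesis
        unfolding 1 \<xi>_0 by (simp add: less_imp_neq[symmetric])
    next
      case 2
      then show ?thesis
        using x(3) \<xi>_1 by simp
    next
      case 3
      then show ?thesis
        using alternating_sum_interior_pos[OF \<alpha> a, of i] n by (simp add: \<xi>_mid)
    next
      case 4
      \<comment> \<open>Reversal contributes \<open>(- 1) ^ n\<close>, so a negative value of the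
        reversed section yields the sign \<open>(- 1) ^ (n - 1)\<close>.\<close>
      have "y ^ n * ((- 1) ^ n * alternating_sum (\<lambda>k. a k * (1 / y) ^ k) n) < 0"
        using y(3) y0 by (simp add: alternating_sum_reciprocal)
      then have "(- 1) ^ n * alternating_sum (\<lambda>k. a k * (1 / y) ^ k) n < 0"
        using y0 by (simp add: mult_less_0_iff)
      moreover have "(- 1) ^ n = - ((- 1) ^ (n - 1) :: real)"
        using n by (cases n) auto
      ultimately show ?thesis
        unfolding 4 \<xi>_pred by simp
    next
      case 5
      \<comment> \<open>The last point is the reciprocal of the first point for the reversed
        sequence.\<close>
      define z where "z = a n / a (n - 1)"
      have z: "z > 0"
        using pos by (simp add: z_def)
      have "0 < alternating_sum (\<lambda>k. a (n - k) * z ^ k) n"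
        using alternating_sum_pos[OF quotients_within_geometric[OF rev z] I] n pos[of "n - 1"]
        by (simp add: z_def)
      then have "0 < (- 1) ^ n * alternating_sum (\<lambda>k. a k * (1 / z) ^ k) n"
        using z by (simp add: alternating_sum_reciprocal zero_less_mult_iff)
      then show ?thesis
        unfolding 5 \<xi>_n by (simp add: z_def)
    qed
  next
    fix i assume "i < n"
    then consider "i = 0" | "i = Suc 0" | "2 \<le> i" "i < n - 2" | "i = n - 2" | "i = n - 1"
      using cases[of i] by linarith
    then show "\<xi> i < \<xi> (Suc i)"
    proof cases
      case 1
      then show ?thesis using x(1) \<xi>_0 \<xi>_1 by simp
    next
      case 2
      have "x < \<xi> 2"
        using x(2) mid(1)[of 2] n by fastforce
      then show ?thesis using 2 \<xi>_1 by (simp add: numeral_2_eq_2)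
    next
      case 3
      then show ?thesis using mid(2)[of i] mid(1)[of "Suc i"] by simp
    next
      case 4
      have "2 \<le> n - 2" "n - 2 + 1 = n - 1" "Suc (n - 2) = n - 1"
        using n by auto
      with mid(2)[of "n - 2"] y_bounds(1) show ?thesis
        unfolding 4 by (metis \<xi>_pred less_trans order_refl)
    next
      case 5
      have "Suc (n - 1) = n"
        using n by auto
      then show ?thesis using 5 y_bounds(2) \<xi>_pred \<xi>_n by simp
    qed
  next
    fix i assume "i < n"
    then consider "i = 0" | "i = Suc 0" | "2 \<le> i" "i \<le> n - 2" | "i = n - 1"
      using cases[of i] by linarith
    then show "a (max 1 i - 1) / a (max 1 i) \<le> \<xi> i"
    proof cases
      case 1
      then show ?thesis using \<xi>_0 by simp
    next
      case 2
      then show ?thesis using x(1) \<xi>_1 by simp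
    next
      case 3
      then show ?thesis using mid(1)[of i] by (simp add: max_def)
    next
      case 4
      have "n - 1 - 1 = n - 2" "max 1 (n - 1) = n - 1"
        using n by auto
      then show ?thesis using 4 y_bounds(1) \<xi>_pred by simp
    qed
  qed
qed

section \<open>Real roots and factorization of a section\<close>

text \<open>The \<open>n + 1\<close> alternating signs give \<open>n\<close> distinct positive roots
  of the section at \<open>- x\<close>. Both sides then agree at the \<open>n\<close> negatives of
  these roots and at 0, one point more than their degrees allow unless they are equal.\<close>

lemma section_factorization:
  assumes \<alpha>: "16 / 5 \<le> \<alpha>" "\<alpha> < 4"
    and a: "quotients_within (hutchinson_interval \<alpha>) a n" and n: "5 \<le> n"
  obtains r :: "nat \<Rightarrow> real" where
    "\<And>i. i < n \<Longrightarrow> a (max 1 i - 1) / a (max 1 i) \<le> r i"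
    "\<And>z :: complex. (\<Sum>k\<le>n. of_real (a k) * z ^ k) =
      of_real (a 0) * (\<Prod>i<n. 1 + z * of_real (1 / r i))"
proof -
  note pos = quotients_within_pos[OF a]
  obtain \<xi> :: "nat \<Rightarrow> real" where
    sign: "\<And>i. i \<le> n \<Longrightarrow> 0 < (- 1) ^ i * alternating_sum (\<lambda>k. a k * \<xi> i ^ k) n"
    and incr: "\<And>i. i < n \<Longrightarrow> \<xi> i < \<xi> (Suc i)"
    and lower: "\<And>i. i < n \<Longrightarrow> a (max 1 i - 1) / a (max 1 i) \<le> \<xi> i"
    using ex_sign_changes[OF \<alpha> a n] by blast
  define p where "p = (\<Sum>k\<le>n. monom ((- 1) ^ k * a k) k)"
  have p: "poly p x = alternating_sum (\<lambda>k. a k * x ^ k) n" for x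
    by (simp add: p_def alternating_sum_def poly_sum poly_monom mult.assoc)
  have "\<exists>x. \<xi> i < x \<and> x < \<xi> (Suc i) \<and> poly p x = 0" if "i < n" for i
  proof -
    have "0 < ((- 1) ^ i * poly p (\<xi> i)) * ((- 1) ^ Suc i * poly p (\<xi> (Suc i)))"
      unfolding p by (rule mult_pos_pos[OF sign sign]) (use that in auto)
    also have "\<dots> = - (poly p (\<xi> i) * poly p (\<xi> (Suc i)))"
      by (simp flip: power_mult_distrib add: algebra_simps)
    finally show ?thesis
      using poly_IVT[OF incr[OF that], of p] by auto
  qed
  then obtain r where r: "\<And>i. i < n \<Longrightarrow> \<xi> i < r i" "\<And>i. i < n \<Longrightarrow> r i < \<xi> (Suc i)"
    "\<And>i. i < n \<Longrightarrow> poly p (r i) = 0"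
    by metis
  have bound: "a (max 1 i - 1) / a (max 1 i) \<le> r i" if "i < n" for i
    using lower[OF that] r(1)[OF that] by linarith
  have r_pos: "r i > 0" if "i < n" for i
    using bound[OF that] pos[of "max 1 i - 1"] pos[of "max 1 i"]
    by (meson divide_pos_pos less_le_trans)
  have r_less: "r i < r j" if "i < j" "j < n" for i j
  proof -
    have "\<xi> (Suc i) \<le> \<xi> k" if "Suc i \<le> k" "k < n" for k
      using that
    proof (induction k rule: dec_induct)
      case (step k)
      then show ?case using incr[of k] by simp
    qed simp
    from this[of j] r(1)[of j] r(2)[of i] that show ?thesis by simp
  qed
  have inj: "inj_on r {..<n}"
    by (rule inj_onI) (metis lessThan_iff less_irrefl nat_neq_iff r_less)
  define P :: "complex poly" where "P = (\<Sum>k\<le>n. monom (of_real (a k)) k)"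
  define Q :: "complex poly" where
    "Q = smult (of_real (a 0)) (\<Prod>i<n. [:1, of_real (1 / r i):])"
  \<comment> \<open>The point 0 fixes the constant factor, which the roots leave open.\<close>
  define A where "A = insert 0 ((\<lambda>i. complex_of_real (- r i)) ` {..<n})"
  have "card ((\<lambda>i. complex_of_real (- r i)) ` {..<n}) = n"
    using inj by (subst card_image) (auto simp: inj_on_def)
  moreover have "0 \<notin> (\<lambda>i. complex_of_real (- r i)) ` {..<n}"
    using r_pos by force
  ultimately have card: "card A = Suc n"
    by (simp add: A_def)
  have P: "poly P z = (\<Sum>k\<le>n. of_real (a k) * z ^ k)" for z
    by (simp add: P_def poly_sum poly_monom)
  have Q: "poly Q z = of_real (a 0) * (\<Prod>i<n. 1 + z * of_real (1 / r i))" for z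
    by (simp add: Q_def poly_prod)
  have "P = Q"
  proof (rule poly_eqI_degree)
    show "poly P z = poly Q z" if zA: "z \<in> A" for z
    proof (cases "z = 0")
      case True
      then show ?thesis by (simp add: P Q power_0_left if_distrib cong: if_cong)
    next
      case False
      then obtain i where i: "i < n" "z = of_real (- r i)"
        using zA by (auto simp: A_def)
      have "poly P z = of_real (poly p (r i))"
        unfolding P p alternating_sum_def i(2) of_real_sum
        by (intro sum.cong) (auto simp: power_minus[of "complex_of_real (r i)"])
      moreover have "1 + z * of_real (1 / r i) = 0"
        using i r_pos[of i] by simp
      then have "poly Q z = 0"
        unfolding Q using i(1) by (metis finite_lessThan lessThan_iff mult_zero_right prod_zero)
      ultimately show ?thesis
        using r(3)[OF i(1)] by simp
    qed
    have "degree P \<le> n"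
      unfolding P_def by (intro degree_sum_le) (auto intro: order.trans[OF degree_monom_le])
    then show "degree P < card A"
      by (simp add: card)
    have "degree Q \<le> (\<Sum>i<n. degree [:1, complex_of_real (1 / r i):])"
      unfolding Q_def
      by (rule order.trans[OF degree_smult_le])
        (use degree_prod_sum_le[OF finite_lessThan] in \<open>simp only: o_def\<close>)
    also have "\<dots> \<le> (\<Sum>i<n. 1)"
      by (intro sum_mono) auto
    finally show "degree Q < card A"
      by (simp add: card)
  qed
  show ?thesis
  proof (rule that[of r, OF bound])
    show "(\<Sum>k\<le>n. of_real (a k) * z ^ k) =
        of_real (a 0) * (\<Prod>i<n. 1 + z * of_real (1 / r i))" for z :: complex
      using P[of z] Q[of z] \<open>P = Q\<close> by simp
  qed
qed

section \<open>Limits of products under a summable bound\<close>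

lemma prod_eq_telescoping_sum:
  fixes h :: "nat \<Rightarrow> 'a :: comm_ring_1"
  shows "(\<Prod>k<n. 1 + h k) = 1 + (\<Sum>k<n. h k * (\<Prod>j<k. 1 + h j))"
  by (induction n) (auto simp: algebra_simps)

text \<open>Telescoping the products turns this into Tannery's theorem for series.\<close>
lemma tannery_prod:
  fixes h :: "nat \<Rightarrow> nat \<Rightarrow> complex"
  assumes lim: "\<And>k. (\<lambda>n. h n k) \<longlonglongrightarrow> g k"
    and bound: "\<And>n k. norm (h n k) \<le> M k" and M: "summable M"
    and zero: "\<And>n k. k \<ge> N n \<Longrightarrow> h n k = 0"
  shows "(\<lambda>n. \<Prod>k<N n. 1 + h n k) \<longlonglongrightarrow> (\<Prod>k. 1 + g k)"
proof -
  have M0: "M k \<ge> 0" for k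
    using bound[of 0 k] norm_ge_zero order_trans by blast
  define C where "C = exp (suminf M)"
  \<comment> \<open>A bound uniform in both indices turns \<open>M\<close> into a summable majorant
    of the telescoped terms.\<close>
  have prod_le: "norm (\<Prod>j<k. 1 + h n j) \<le> C" for n k
  proof -
    have "norm (\<Prod>j<k. 1 + h n j) \<le> (\<Prod>j<k. 1 + M j)"
      unfolding prod_norm[symmetric]
      by (intro prod_mono conjI norm_ge_zero order.trans[OF norm_triangle_ineq] add_mono bound) auto
    also have "\<dots> \<le> exp (\<Sum>j<k. M j)"
      by (rule prod_le_exp_sum) (use M0 in auto)
    also have "\<dots> \<le> C"
      unfolding C_def exp_le_cancel_iff using M0 by (intro sum_le_suminf M) auto
    finally show ?thesis .
  qed
  define A where "A k n = h n k * (\<Prod>j<k. 1 + h n j)" for k n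
  define B where "B k = g k * (\<Prod>j<k. 1 + g j)" for k
  have AB: "(\<lambda>n. A k n) \<longlonglongrightarrow> B k" for k
    unfolding A_def B_def by (intro tendsto_intros lim)
  have A_le: "norm (A k n) \<le> M k * C" for k n
    unfolding A_def norm_mult by (intro mult_mono bound prod_le M0) auto
  have tannery: "summable (\<lambda>k. norm (B k))" "(\<lambda>n. \<Sum>k. A k n) \<longlonglongrightarrow> (\<Sum>k. B k)"
    using tannerys_theorem[where a = A and b = B and M = "\<lambda>k. M k * C", OF AB] A_le M
    by (auto intro: summable_mult2 always_eventually)
  have sum_A: "(\<Prod>k<N n. 1 + h n k) = 1 + (\<Sum>k. A k n)" for n
  proof -
    have "(\<Sum>k. A k n) = (\<Sum>k<N n. A k n)"
      using zero by (intro suminf_finite) (auto simp: A_def)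
    moreover have "(\<Prod>k<N n. 1 + h n k) = 1 + (\<Sum>k<N n. A k n)"
      unfolding A_def by (rule prod_eq_telescoping_sum)
    ultimately show ?thesis
      by simp
  qed
  have sum_B: "(\<Prod>j<k. 1 + g j) = 1 + (\<Sum>i<k. B i)" for k
    unfolding B_def by (rule prod_eq_telescoping_sum)
  have "(\<lambda>k. \<Prod>j<k. 1 + g j) \<longlonglongrightarrow> 1 + (\<Sum>k. B k)"
    unfolding sum_B
    by (rule tendsto_add[OF tendsto_const summable_LIMSEQ[OF summable_norm_cancel[OF tannery(1)]]])
  \<comment> \<open>The bound passes to the limit \<open>g\<close>, so the infinite product
    converges and its value is the limit of the partial products.\<close>
  moreover have "norm (g k) \<le> M k" for k
    by (rule LIMSEQ_le_const2[OF tendsto_norm[OF lim]]) (use bound in blast)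
  then have "summable (\<lambda>k. norm (g k))"
    using M by (intro summable_comparison_test[OF _ M]) auto
  then have "convergent_prod (\<lambda>k. 1 + g k)"
    by (intro abs_convergent_prod_imp_convergent_prod summable_imp_abs_convergent_prod) simp
  then have "(\<lambda>k. \<Prod>j<Suc k. 1 + g j) \<longlonglongrightarrow> (\<Prod>k. 1 + g k)"
    unfolding lessThan_Suc_atMost by (rule convergent_prod_LIMSEQ)
  then have "(\<lambda>k. \<Prod>j<k. 1 + g j) \<longlonglongrightarrow> (\<Prod>k. 1 + g k)"
    by (rule LIMSEQ_imp_Suc)
  ultimately have "(\<Prod>k. 1 + g k) = 1 + (\<Sum>k. B k)"
    using LIMSEQ_unique by blast
  then show ?thesis
    unfolding sum_A by (simp only:) (rule tendsto_add[OF tendsto_const tannery(2)])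
qed

section \<open>Compactness of a box of sequences\<close>

text \<open>Tychonoff's theorem in place of a diagonal argument: the box is compact in the product
  topology, which is first countable here, so compactness yields convergent subsequences.\<close>

lemma ex_convergent_subsequence_componentwise:
  fixes y :: "nat \<Rightarrow> nat \<Rightarrow> real"
  assumes "\<And>n k. y n k \<in> {0..M k}"
  obtains l s where "strict_mono s" "\<And>k. l k \<in> {0..M k}" "\<And>k. (\<lambda>n. y (s n) k) \<longlonglongrightarrow> l k"
proof -
  define S where "S = (\<Pi>\<^sub>E k\<in>UNIV. {0..M k})"
  have "compactin (product_topology (\<lambda>_. euclidean) UNIV) S"
    unfolding S_def compactin_PiE by simp
  then have "compact S"
    by (simp add: euclidean_product_topology)
  moreover have "y n \<in> S" for n
    using assms by (auto simp: S_def)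
  ultimately obtain l s where l: "l \<in> S" "strict_mono s" "(y \<circ> s) \<longlonglongrightarrow> l"
    using compact_imp_seq_compact[of S] unfolding seq_compact_def by blast
  show ?thesis
  proof (rule that)
    show "strict_mono s" by (fact l(2))
    show "l k \<in> {0..M k}" for k
      using l(1) by (auto simp: S_def PiE_iff)
    fix k
    have "continuous_on UNIV (\<lambda>x :: nat \<Rightarrow> real. x k)"
      by (rule continuous_on_product_coordinates)
    then have "isCont (\<lambda>x. x k) l"
      unfolding continuous_on_eq_continuous_at[OF open_UNIV] by blast
    from isCont_tendsto_compose[OF this l(3)] show "(\<lambda>n. y (s n) k) \<longlonglongrightarrow> l k"
      by (simp add: o_def)
  qed
qed

section \<open>From the products to the Laguerre-Polya class\<close>

text \<open>As \<open>l\<close> is summable, the convergence factors multiply to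
  \<open>exp (- (z * \<delta>))\<close> with \<delta> the sum of \<open>l\<close>; the factor
  \<open>exp (\<delta> * z)\<close> of the normal form cancels them.\<close>

lemma laguerre_polya_genus_zero:
  fixes l :: "nat \<Rightarrow> real"
  assumes f: "real_entire f" and l: "summable l" "\<And>k. l k \<ge> 0"
    and f_eq: "\<And>z. f z = of_real c * (\<Prod>k. 1 + z * of_real (l k))"
  shows "laguerre_polya f"
  unfolding laguerre_polya_def
proof (intro conjI exI)
  \<comment> \<open>An index with \<open>l k = 0\<close> belongs to no root: its factor is 1, and
    \<open>x k\<close> would be 0 by division by zero.\<close>
  define K where "K = {k. l k \<noteq> 0}"
  define x where "x k = - 1 / l k" for k
  show "real_entire f" by (fact f)
  show "(0 :: real) \<le> 0" by simp
  show "\<forall>k\<in>K. x k \<noteq> 0"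
    by (simp add: K_def x_def)
  have "summable (\<lambda>k. (l k)\<^sup>2)"
  proof (rule summable_comparison_test_ev)
    have "eventually (\<lambda>k. l k < 1) sequentially"
      using summable_LIMSEQ_zero[OF l(1)] by (rule order_tendstoD) simp
    then show "eventually (\<lambda>k. norm ((l k)\<^sup>2) \<le> l k) sequentially"
    proof eventually_elim
      case (elim k)
      then show ?case
        using mult_left_mono[of "l k" 1 "l k"] l(2)[of k] by (simp add: power2_eq_square)
    qed
  qed (fact l(1))
  then have "(\<lambda>k. (l k)\<^sup>2) summable_on K"
    by (intro summable_on_subset_banach[OF norm_summable_imp_summable_on, of _ K]) auto
  then show "(\<lambda>k. 1 / (x k)\<^sup>2) summable_on K"
    by (simp add: x_def power_divide)
  define \<delta> where "\<delta> = suminf l"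
  show "\<forall>z. \<exists>P. (\<lambda>k. if k \<in> K then (1 - z / of_real (x k)) * exp (z / of_real (x k)) else 1)
      has_prod P \<and> f z = of_real c * z ^ 0 * exp (- of_real 0 * z\<^sup>2 + of_real \<delta> * z) * P"
  proof (intro allI exI conjI)
    fix z :: complex
    have sum_l: "(\<lambda>k. - (z * of_real (l k))) sums - (z * of_real \<delta>)"
      unfolding \<delta>_def using l(1) by (intro sums_minus sums_mult sums_of_real summable_sums)
    have "summable (\<lambda>k. norm (z * of_real (l k)))"
      using l by (simp add: norm_mult summable_mult)
    then have conv: "convergent_prod (\<lambda>k. 1 + z * of_real (l k))"
      by (intro abs_convergent_prod_imp_convergent_prod summable_imp_abs_convergent_prod) simp
    have conv_exp: "convergent_prod (\<lambda>k. exp (- (z * of_real (l k))))"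
      using sum_l by (intro convergent_prod_exp) (simp add: sums_iff)
    have prod_exp: "(\<Prod>k. exp (- (z * of_real (l k)))) = exp (- (z * of_real \<delta>))"
      using prodinf_exp[of "\<lambda>k. - (z * of_real (l k))"] sum_l by (simp add: sums_iff)
    have "(\<lambda>k. (1 + z * of_real (l k)) * exp (- (z * of_real (l k)))) has_prod
        ((\<Prod>k. 1 + z * of_real (l k)) * exp (- (z * of_real \<delta>)))"
      unfolding prod_exp[symmetric] by (intro has_prod_mult convergent_prod_has_prod conv conv_exp)
    moreover have "(1 + z * of_real (l k)) * exp (- (z * of_real (l k))) =
        (if k \<in> K then (1 - z / of_real (x k)) * exp (z / of_real (x k)) else 1)" for k
      by (simp add: K_def x_def)
    ultimately show "(\<lambda>k. if k \<in> K then (1 - z / of_real (x k)) * exp (z / of_real (x k)) else 1)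
        has_prod ((\<Prod>k. 1 + z * of_real (l k)) * exp (- (z * of_real \<delta>)))"
      by simp
    show "f z = of_real c * z ^ 0 * exp (- of_real 0 * z\<^sup>2 + of_real \<delta> * z) *
        ((\<Prod>k. 1 + z * of_real (l k)) * exp (- (z * of_real \<delta>)))"
      by (simp add: f_eq exp_minus mult.commute field_simps)
  qed
qed

theorem corollary2p2:
  fixes f :: "complex \<Rightarrow> complex" and a :: "nat \<Rightarrow> real" and \<alpha> :: real
  assumes "f holomorphic_on UNIV"
    and "\<And>z. (\<lambda>k. of_real (a k) * z ^ k) sums f z"
    and "\<And>k. a k > 0"
    and "1 + sqrt 5 \<le> \<alpha>" and "\<alpha> < 4"
    and "\<And>k. k \<ge> 2 \<Longrightarrow> second_quotient a k \<in> {\<alpha> .. 8 / (\<alpha> * (4 - \<alpha>))}"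
  shows "laguerre_polya f"
proof -
  have "11 / 5 \<le> sqrt 5"
    by (rule real_le_rsqrt) (simp add: power2_eq_square)
  then have \<alpha>: "16 / 5 \<le> \<alpha>" "\<alpha> < 4"
    using assms(4,5) by auto
  have a: "quotients_within (hutchinson_interval \<alpha>) a n" for n
    using assms(3,6) by (simp add: quotients_within_def)
  \<comment> \<open>\<open>M k\<close> bounds the reciprocal of the \<open>k\<close>-th root of
    every section that has one; \<open>M 0\<close> equals \<open>M 1\<close>.\<close>
  define M where "M k = a (max 1 k) / a (max 1 k - 1)" for k
  have M_pos: "M k > 0" for k
    using assms(3) by (simp add: M_def)
  have "summable M"
  \<comment> \<open>From index 1 on, \<open>M (Suc k) / M k\<close> is the reciprocal of a second
    quotient, hence at most \<open>1 / \<alpha>\<close>.\<close>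
  proof (rule summable_ratio_test)
    show "1 / \<alpha> < 1" using \<alpha> by simp
    fix k :: nat assume "k \<ge> 1"
    then obtain j where j: "k = Suc j" by (cases k) auto
    have "\<alpha> \<le> (a (j + 1))\<^sup>2 / (a j * a (j + 2))"
      using quotients_withinD[OF a, of j "j + 2"] by simp
    then have "a (j + 2) / a (j + 1) \<le> 1 / \<alpha> * (a (j + 1) / a j)"
      using assms(3) \<alpha> by (simp add: field_simps power2_eq_square)
    then show "norm (M (Suc k)) \<le> 1 / \<alpha> * norm (M k)"
      using assms(3) by (simp add: M_def j less_imp_le)
  qed
  \<comment> \<open>The factorization starts at degree 5, hence the offset.\<close>
  have "\<exists>r :: nat \<Rightarrow> real. (\<forall>i<n + 5. 1 / M i \<le> r i) \<and>
    (\<forall>z :: complex. (\<Sum>k\<le>n + 5. of_real (a k) * z ^ k) =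
      of_real (a 0) * (\<Prod>i<n + 5. 1 + z * of_real (1 / r i)))" for n
  proof -
    obtain r where "\<And>i. i < n + 5 \<Longrightarrow> a (max 1 i - 1) / a (max 1 i) \<le> r i"
      "\<And>z :: complex. (\<Sum>k\<le>n + 5. of_real (a k) * z ^ k) =
        of_real (a 0) * (\<Prod>i<n + 5. 1 + z * of_real (1 / r i))"
      by (rule section_factorization[OF \<alpha> a, of "n + 5"]) auto
    then show ?thesis
      by (intro exI[of _ r]) (simp add: M_def)
  qed
  then have "\<forall>n. \<exists>r :: nat \<Rightarrow> real. (\<forall>i<n + 5. 1 / M i \<le> r i) \<and>
    (\<forall>z :: complex. (\<Sum>k\<le>n + 5. of_real (a k) * z ^ k) =
      of_real (a 0) * (\<Prod>i<n + 5. 1 + z * of_real (1 / r i)))" ..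
  from choice[OF this] obtain r :: "nat \<Rightarrow> nat \<Rightarrow> real" where
    r: "\<And>n i. i < n + 5 \<Longrightarrow> 1 / M i \<le> r n i"
    and section_eq: "\<And>n z. (\<Sum>k\<le>n + 5. complex_of_real (a k) * z ^ k) =
      of_real (a 0) * (\<Prod>i<n + 5. 1 + z * of_real (1 / r n i))"
    by blast
  \<comment> \<open>Reciprocals of roots stay bounded while roots may escape to infinity; the
    padding by 0 stands for factors 1.\<close>
  define y where "y n i = (if i < n + 5 then 1 / r n i else 0)" for n i
  have y_bounds: "y n i \<in> {0..M i}" for n i
  proof (cases "i < n + 5")
    case True
    have "0 < 1 / M i"
      using M_pos[of i] by simp
    moreover have *: "1 / M i \<le> r n i"
      using r True by auto
    ultimately have "0 < r n i"
      by (rule less_le_trans)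
    with * show ?thesis
      using True M_pos[of i] by (simp add: y_def field_simps)
  qed (use M_pos[of i] in \<open>simp add: y_def\<close>)
  obtain l s where s: "strict_mono s" and l: "\<And>k. l k \<in> {0..M k}"
    and lim: "\<And>k. (\<lambda>n. y (s n) k) \<longlonglongrightarrow> l k"
    by (rule ex_convergent_subsequence_componentwise[of y M, OF y_bounds]) (rule that)
  have N: "filterlim (\<lambda>n. s n + 5) sequentially sequentially"
    using s by (intro filterlim_subseq) (simp add: strict_mono_def)
  have f_eq: "f z = of_real (a 0) * (\<Prod>k. 1 + z * of_real (l k))" for z
  proof -
    have "(\<lambda>n. \<Prod>k<s n + 5. 1 + z * of_real (y (s n) k)) \<longlonglongrightarrow> (\<Prod>k. 1 + z * of_real (l k))"
    proof (rule tannery_prod[where M = "\<lambda>k. norm z * M k"])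
      show "norm (z * of_real (y (s n) k)) \<le> norm z * M k" for n k
        using y_bounds[of "s n" k] by (simp add: norm_mult mult_left_mono)
      show "summable (\<lambda>k. norm z * M k)"
        using \<open>summable M\<close> by (rule summable_mult)
      show "(\<lambda>n. z * of_real (y (s n) k)) \<longlonglongrightarrow> z * of_real (l k)" for k
        by (intro tendsto_mult_left tendsto_of_real lim)
    qed (auto simp: y_def)
    then have "(\<lambda>n. of_real (a 0) * (\<Prod>k<s n + 5. 1 + z * of_real (y (s n) k)))
        \<longlonglongrightarrow> of_real (a 0) * (\<Prod>k. 1 + z * of_real (l k))"
      by (rule tendsto_mult_left)
    moreover have "of_real (a 0) * (\<Prod>k<s n + 5. 1 + z * of_real (y (s n) k)) =
        (\<Sum>k\<le>s n + 5. of_real (a k) * z ^ k)" for n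
      by (simp add: section_eq y_def)
    moreover have "(\<lambda>n. \<Sum>k\<le>s n + 5. of_real (a k) * z ^ k) \<longlonglongrightarrow> f z"
      using assms(2)[of z] N unfolding sums_def_le by (rule filterlim_compose)
    ultimately show ?thesis
      using LIMSEQ_unique by simp
  qed
  have "f (of_real t) \<in> \<real>" for t
  proof -
    have "(\<lambda>k. complex_of_real (a k * t ^ k)) sums f (of_real t)"
      using assms(2)[of "of_real t"] by simp
    then show ?thesis
      unfolding sums_def by (rule Lim_in_closed_set[OF closed_complex_Reals, rotated 2]) auto
  qed
  then have "real_entire f"
    using assms(1) by (simp add: real_entire_def)
  moreover have "summable l"
    using l by (intro summable_comparison_test[OF _ \<open>summable M\<close>]) auto
  ultimately show ?thesis
    using l f_eq by (intro laguerre_polya_genus_zero) auto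
qed

end
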